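(* Let $R$ be a commutative ring with $2R=R$ and let $I$ be an ideal of $R$. Then for $n\ge2$ the natural map of orbit sets $$\mathrm{Um}_{2n}(R,I)/\mathrm{ESp}_{2n}(R,I)\longrightarrow\mathrm{Um}_{2n}(R,I)/\mathrm{E}_{2n}(R,I)$$ is bijective.
   Context: $\mathrm{Um}_k(R,I)$ is the set of unimodular rows $v=(v_1,\dots,v_k)\in R^k$ (i.e. $\sum v_iw_i=1$ for some $w_i\in R$) congruent to $e_1=(1,0,\dots,0)$ modulo $I$. Matrices act on rows by right multiplication. $\mathrm{E}_k(R)$ is generated by the matrices $I_k+\lambda e_{ij}$ ($i\neq j$, $\lambda\in R$); $\mathrm{E}_k(R,I)$ is the normal closure in $\mathrm{E}_k(R)$ of the subgroup generated by those with $\lambda\in I$. Let $\sigma$ be the permutation $\sigma(2i)=2i-1$, $\sigma(2i-1)=2i$. For $z\in R$ and $1\le i\ne j\le 2n$ set $se_{ij}(z)=1_{2n}+ze_{ij}$ if $i=\sigma(j)$, and $se_{ij}(z)=1_{2n}+ze_{ij}-(-1)^{i+j}ze_{\sigma(j)\sigma(i)}$ if $i\ne\sigma(j)$. $\mathrm{ESp}_{2n}(R)$ is the group generated by all $se_{ij}(z)$, $z\in R$; $\mathrm{ESp}_{2n}(I)$ is the subgroup generated by all $se_{ij}(x)$, $x\in I$; $\mathrm{ESp}_{2n}(R,I)$ is the normal closure of $\mathrm{ESp}_{2n}(I)$ in $\mathrm{ESp}_{2n}(R)$. *)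

theory Defs
  imports "Jordan_Normal_Form.VS_Connect" "HOL-Algebra.Ideal" "HOL-Algebra.Generated_Groups"
begin

text \<open>Rows and columns are numbered from \<open>0\<close>, as everywhere for matrices of type \<open>'a mat\<close>;
  the index \<open>i\<close> of the mathematical text is \<open>i - 1\<close> here. In particular \<open>e\<^sub>1\<close> is \<open>unit_vec k 0\<close>.\<close>

definition row_mult :: "'a::comm_ring_1 vec \<Rightarrow> 'a mat \<Rightarrow> 'a vec" where
  "row_mult v M = vec (dim_col M) (\<lambda>j. v \<bullet> col M j)"

definition Um :: "nat \<Rightarrow> 'a::comm_ring_1 set \<Rightarrow> 'a vec set" where
  "Um k I = {v \<in> carrier_vec k.
     (\<exists>w \<in> carrier_vec k. v \<bullet> w = 1) \<and> (\<forall>i<k. v $ i - unit_vec k 0 $ i \<in> I)}"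

definition GL :: "nat \<Rightarrow> 'a::comm_ring_1 mat monoid" where
  "GL k = units_of (ring_mat TYPE('a) k ())"

definition normal_closure :: "('g, 'b) monoid_scheme \<Rightarrow> 'g set \<Rightarrow> 'g set" where
  "normal_closure G H = \<Inter> {N. N \<lhd> G \<and> H \<subseteq> N}"

definition mat_unit :: "nat \<Rightarrow> nat \<Rightarrow> nat \<Rightarrow> 'a::comm_ring_1 mat" where
  "mat_unit k i j = mat k k (\<lambda>(p, q). if p = i \<and> q = j then 1 else 0)"

definition elem_mat :: "nat \<Rightarrow> nat \<Rightarrow> nat \<Rightarrow> 'a::comm_ring_1 \<Rightarrow> 'a mat" where
  "elem_mat k i j a = 1\<^sub>m k + a \<cdot>\<^sub>m mat_unit k i j"

text \<open>The subgroup generated by the elementary matrices with entry in \<open>X\<close>;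
  \<open>E\<^sub>k(R)\<close> is the case \<open>X = UNIV\<close>.\<close>

definition E_gen :: "nat \<Rightarrow> 'a::comm_ring_1 set \<Rightarrow> 'a mat set" where
  "E_gen k X = generate (GL k) {elem_mat k i j a | i j a. i < k \<and> j < k \<and> i \<noteq> j \<and> a \<in> X}"

definition E_rel :: "nat \<Rightarrow> 'a::comm_ring_1 set \<Rightarrow> 'a mat set" where
  "E_rel k I = normal_closure ((GL k) \<lparr>carrier := E_gen k UNIV\<rparr>) (E_gen k I)"

text \<open>With indices from \<open>0\<close>, the permutation \<open>2i \<mapsto> 2i - 1\<close>, \<open>2i - 1 \<mapsto> 2i\<close> exchanges
  \<open>2i\<close> and \<open>2i + 1\<close>; the sign \<open>(-1)\<^bsup>i+j\<^esup>\<close> is not affected by the shift.\<close>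

definition sp_perm :: "nat \<Rightarrow> nat" where
  "sp_perm i = (if even i then i + 1 else i - 1)"

definition se_mat :: "nat \<Rightarrow> nat \<Rightarrow> nat \<Rightarrow> 'a::comm_ring_1 \<Rightarrow> 'a mat" where
  "se_mat n i j z =
     (if i = sp_perm j then 1\<^sub>m (2 * n) + z \<cdot>\<^sub>m mat_unit (2 * n) i j
      else 1\<^sub>m (2 * n) + z \<cdot>\<^sub>m mat_unit (2 * n) i j
             - ((-1) ^ (i + j) * z) \<cdot>\<^sub>m mat_unit (2 * n) (sp_perm j) (sp_perm i))"

text \<open>In \<open>ESp_gen n X\<close> and \<open>ESp_rel n I\<close> the matrices have size \<open>2n\<close>.\<close>

definition ESp_gen :: "nat \<Rightarrow> 'a::comm_ring_1 set \<Rightarrow> 'a mat set" where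
  "ESp_gen n X =
     generate (GL (2 * n)) {se_mat n i j z | i j z. i < 2 * n \<and> j < 2 * n \<and> i \<noteq> j \<and> z \<in> X}"

definition ESp_rel :: "nat \<Rightarrow> 'a::comm_ring_1 set \<Rightarrow> 'a mat set" where
  "ESp_rel n I = normal_closure ((GL (2 * n)) \<lparr>carrier := ESp_gen n UNIV\<rparr>) (ESp_gen n I)"

definition row_orbit :: "'a::comm_ring_1 mat set \<Rightarrow> 'a vec \<Rightarrow> 'a vec set" where
  "row_orbit H v = {row_mult v M | M. M \<in> H}"

definition row_orbits :: "'a::comm_ring_1 vec set \<Rightarrow> 'a mat set \<Rightarrow> 'a vec set set" where
  "row_orbits U H = {row_orbit H v | v. v \<in> U}"

text \<open>The map \<open>vH \<mapsto> vK\<close> on orbits, for \<open>H \<subseteq> K\<close>, written without choosing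
  a representative: \<open>C \<mapsto> CK\<close>.\<close>

definition orbit_map :: "'a::comm_ring_1 mat set \<Rightarrow> 'a vec set \<Rightarrow> 'a vec set" where
  "orbit_map K C = (\<Union>v\<in>C. row_orbit K v)"

end

theory Submission
  imports Defs "HOL-Library.Function_Algebras"
begin

text \<open>
  For every unimodular row \<open>v\<close> of length \<open>2n\<close> the orbits \<open>v E\<^sub>2\<^sub>n(R, I)\<close> and \<open>v ESp\<^sub>2\<^sub>n(R, I)\<close> are equal as
  sets of rows. The two orbit sets are then literally the same set, and the map between them is
  the identity.

  The core is the absolute statement: a single elementary operation \<open>v\<^sub>j \<mapsto> v\<^sub>j + b v\<^sub>i\<close> on a unimodular
  row is a composite of symplectic elementary operations, whose coefficients may depend on \<open>v\<close>. If
  \<open>i = \<sigma>(j)\<close>, the operation is itself a long root generator. Otherwise a symplectic generator with a coefficient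
  that is a multiple of \<open>v\<^sub>k\<close> has a side effect that a long root generator can repair, and this adds
  \<open>b v\<^sub>k\<^sup>2\<close> to \<open>v\<^sub>j\<close> (\<open>reach_square\<close>). Polarization yields \<open>b v\<^sub>k v\<^sub>l\<close>, since \<open>2\<close> is invertible
  (\<open>reach_product\<close>), and a commutator-like detour through the entry at \<open>\<sigma>(i)\<close> yields
  \<open>b v\<^sub>i v\<^sub>j\<close> (\<open>reach_self_product\<close>). If \<open>\<Sum> q\<^sub>k v\<^sub>k = 1\<close>, then \<open>b v\<^sub>i\<close> is the sum of the
  \<open>b v\<^sub>i q\<^sub>k v\<^sub>k\<close>, each of which is of one of these kinds or a multiple of the entry at \<open>\<sigma>(j)\<close>
  (\<open>reach_elementary\<close>).

  The relative statement follows from the absolute one over the ring \<open>D\<close> of pairs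
  \<open>(a, b)\<close> in \<open>R \<times> R\<close> with \<open>a - b \<in> I\<close>. An element \<open>M\<close> of \<open>E\<^sub>2\<^sub>n(R, I)\<close> gives an element \<open>(M, 1)\<close>
  of \<open>E\<^sub>2\<^sub>n(D)\<close> (\<open>normal_closure_eq_congruent_words\<close>). By the absolute case some \<open>(A, B)\<close> in
  \<open>ESp\<^sub>2\<^sub>n(D)\<close> satisfies \<open>v A = v M\<close> and \<open>v B = v\<close> (\<open>E_words_simulated_by_ESp_words\<close>). Since \<open>A\<close> and \<open>B\<close> are
  words with coefficients congruent modulo \<open>I\<close>, the matrix \<open>B\<^sup>-\<^sup>1 A\<close> lies in \<open>ESp\<^sub>2\<^sub>n(R, I)\<close>
  (\<open>congruent_words_factor\<close>), and it maps \<open>v\<close> to \<open>v M\<close>.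
\<close>

section \<open>Normal closures and words with congruent coefficients\<close>

text \<open>The common features of the generators \<open>1 + \<lambda> e\<^sub>i\<^sub>j\<close> and \<open>se\<^sub>i\<^sub>j(z)\<close>: a family of one-parameter subgroups.
The index \<open>i\<close> of the family stands for a pair of matrix indices.\<close>

locale additive_family = group G for G (structure) +
  fixes J :: "'i set" and x :: "'i \<Rightarrow> 'r::ab_group_add \<Rightarrow> 'a"
  assumes closed: "i \<in> J \<Longrightarrow> x i a \<in> carrier G"
    and add: "i \<in> J \<Longrightarrow> x i (a + b) = x i a \<otimes> x i b"
begin

definition gen_subgroup :: "'r set \<Rightarrow> 'a set" where
  "gen_subgroup X = generate G {x i a | i a. i \<in> J \<and> a \<in> X}"

text \<open>For an ideal \<open>I\<close> the pairs \<open>(a, b)\<close> with \<open>a - b \<in> I\<close> form a ring. These are the values of words in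
  generators \<open>x i (a, b)\<close> over that ring, each word being evaluated in both coordinates. Working with such pairs turns
  statements relative to \<open>I\<close> into absolute ones.\<close>

inductive_set congruent_words :: "'r set \<Rightarrow> ('a \<times> 'a) set" for I where
  one: "(\<one>, \<one>) \<in> congruent_words I"
| snoc: "(A, B) \<in> congruent_words I \<Longrightarrow> i \<in> J \<Longrightarrow> a - b \<in> I \<Longrightarrow>
    (A \<otimes> x i a, B \<otimes> x i b) \<in> congruent_words I"

lemma zero: "i \<in> J \<Longrightarrow> x i 0 = \<one>"
  using add[of i 0 0] closed[of i 0] by (metis add.right_neutral r_cancel_one')

lemma uminus: "i \<in> J \<Longrightarrow> inv (x i a) = x i (- a)"
  using add[of i "-a" a] zero[of i] closed by (metis add.left_inverse inv_equality)

lemma subgroup_gen_subgroup: "subgroup (gen_subgroup X) G"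
  unfolding gen_subgroup_def by (rule generate_is_subgroup) (use closed in auto)

lemma gen_subgroup_incl: "i \<in> J \<Longrightarrow> a \<in> X \<Longrightarrow> x i a \<in> gen_subgroup X"
  unfolding gen_subgroup_def by (rule generate.incl) auto

lemma congruent_words_gen_subgroup:
  "(A, B) \<in> congruent_words I \<Longrightarrow> A \<in> gen_subgroup UNIV \<and> B \<in> gen_subgroup UNIV"
proof (induction rule: congruent_words.induct)
  case one
  show ?case using subgroup.one_closed[OF subgroup_gen_subgroup] by simp
next
  case (snoc A B i a b)
  then show ?case using subgroup.m_closed[OF subgroup_gen_subgroup] gen_subgroup_incl by blast
qed

lemma gen_subgroup_carrier: "A \<in> gen_subgroup X \<Longrightarrow> A \<in> carrier G"
  using subgroup.subset[OF subgroup_gen_subgroup] by blast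

lemma congruent_words_carrier:
  "(A, B) \<in> congruent_words I \<Longrightarrow> A \<in> carrier G \<and> B \<in> carrier G"
  using congruent_words_gen_subgroup gen_subgroup_carrier by blast

lemma congruent_words_gen:
  "i \<in> J \<Longrightarrow> a - b \<in> I \<Longrightarrow> (x i a, x i b) \<in> congruent_words I"
  using congruent_words.snoc[OF congruent_words.one, of i a b I] closed by simp

lemma congruent_words_mult:
  assumes "(A, B) \<in> congruent_words I" "(C, D) \<in> congruent_words I"
  shows "(A \<otimes> C, B \<otimes> D) \<in> congruent_words I"
  using assms(2)
proof (induction rule: congruent_words.induct)
  case one
  then show ?case using assms(1) congruent_words_carrier[OF assms(1)] by simp
next
  case (snoc C D i a b)
  then show ?case
    using congruent_words.snoc[OF snoc.IH snoc.hyps(2,3)] closed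
      congruent_words_carrier[OF assms(1)] congruent_words_carrier[OF snoc.hyps(1)]
    by (simp add: m_assoc)
qed

lemma congruent_words_inv:
  assumes "(A, B) \<in> congruent_words I" and "\<forall>a\<in>I. - a \<in> I"
  shows "(inv A, inv B) \<in> congruent_words I"
  using assms(1)
proof (induction rule: congruent_words.induct)
  case one
  show ?case using congruent_words.one by simp
next
  case (snoc A B i a b)
  have "- a - - b \<in> I"
    using assms(2) snoc.hyps(3) by fastforce
  then have "(x i (- a) \<otimes> inv A, x i (- b) \<otimes> inv B) \<in> congruent_words I"
    by (intro congruent_words_mult congruent_words_gen snoc)
  then show ?case
    using snoc.hyps(2) closed congruent_words_carrier[OF snoc.hyps(1)]
    by (simp add: inv_mult_group uminus)
qed

lemma congruent_words_diag:
  assumes "A \<in> gen_subgroup UNIV" and "0 \<in> I"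
  shows "(A, A) \<in> congruent_words I"
  using assms(1) unfolding gen_subgroup_def
proof (induction rule: generate.induct)
  case one
  show ?case by (rule congruent_words.one)
next
  case (incl h)
  then show ?case using congruent_words_gen[of _ _ _ I] assms(2) by auto
next
  case (inv h)
  then show ?case using congruent_words_gen[of _ _ _ I] assms(2) by (auto simp: uminus)
next
  case (eng h1 h2)
  then show ?case using congruent_words_mult by blast
qed

lemma subgroup_kernel:
  assumes "\<forall>a\<in>I. - a \<in> I"
  shows "subgroup {A. (A, \<one>) \<in> congruent_words I} G" (is "subgroup ?K G")
proof (rule subgroupI)
  show "?K \<subseteq> carrier G" using congruent_words_carrier by blast
  show "?K \<noteq> {}" using congruent_words.one by blast
  show "inv A \<in> ?K" if "A \<in> ?K" for A
    using congruent_words_inv[OF _ assms, of A \<one>] that by simp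
  show "A \<otimes> B \<in> ?K" if "A \<in> ?K" "B \<in> ?K" for A B
    using congruent_words_mult[of A \<one> I B \<one>] that by simp
qed

text \<open>The words over \<open>{(a, b). a - b \<in> I}\<close> whose second coordinate is trivial form the kernel of a
  projection that is split by the diagonal, which makes them normal. They are no more than the
  normal closure because \<open>x i (- b) \<otimes> C \<otimes> x i a\<close> is the conjugate \<open>x i (- b) \<otimes> C \<otimes> x i b\<close> times
  \<open>x i (a - b)\<close>, so that \<open>inv B \<otimes> A\<close> stays in any normal subgroup containing the \<open>x i c\<close>, \<open>c \<in> I\<close>.\<close>

theorem normal_closure_eq_congruent_words:
  assumes zero_I: "0 \<in> I" and uminus_I: "\<forall>a\<in>I. - a \<in> I"
  shows "normal_closure (G\<lparr>carrier := gen_subgroup UNIV\<rparr>) (gen_subgroup I) = {A. (A, \<one>) \<in> congruent_words I}"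
    (is "normal_closure ?H _ = ?K")
proof
  interpret H: group ?H by (rule subgroup_imp_group[OF subgroup_gen_subgroup])
  note inv_H = m_inv_consistent[OF subgroup_gen_subgroup]
  note K_G = subgroup_kernel[OF uminus_I]
  have "?K \<subseteq> gen_subgroup UNIV" using congruent_words_gen_subgroup by blast
  then have K_sub: "subgroup ?K ?H" by (rule subgroup_incl[OF K_G subgroup_gen_subgroup])
  have "?K \<lhd> ?H"
    unfolding H.normal_inv_iff
  proof (intro conjI ballI K_sub)
    fix g A assume "g \<in> carrier ?H" and A: "A \<in> ?K"
    then have g: "g \<in> gen_subgroup UNIV" by simp
    note gg = congruent_words_diag[OF g zero_I]
    have "(g \<otimes> A \<otimes> inv g, g \<otimes> \<one> \<otimes> inv g) \<in> congruent_words I"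
      using A by (intro congruent_words_mult congruent_words_inv gg uminus_I) auto
    then show "g \<otimes>\<^bsub>?H\<^esub> A \<otimes>\<^bsub>?H\<^esub> inv\<^bsub>?H\<^esub> g \<in> ?K"
      using gen_subgroup_carrier[OF g] by (simp add: inv_H[OF g])
  qed
  moreover have "gen_subgroup I \<subseteq> ?K"
    unfolding gen_subgroup_def
  proof (rule generate_subgroup_incl[OF _ K_G])
    show "{x i a |i a. i \<in> J \<and> a \<in> I} \<subseteq> ?K"
      using congruent_words_gen[of _ _ 0 I] zero by auto
  qed
  ultimately show "normal_closure ?H (gen_subgroup I) \<subseteq> ?K"
    unfolding normal_closure_def by blast
  show "?K \<subseteq> normal_closure ?H (gen_subgroup I)"
    unfolding normal_closure_def
  proof (intro subsetI InterI)
    fix A N assume A: "A \<in> ?K" and "N \<in> {N. N \<lhd> ?H \<and> gen_subgroup I \<subseteq> N}"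
    then have N: "N \<lhd> ?H" "gen_subgroup I \<subseteq> N" by auto
    from N(1) have N_sub: "subgroup N ?H"
      and N_conj: "\<And>g h. g \<in> gen_subgroup UNIV \<Longrightarrow> h \<in> N \<Longrightarrow> g \<otimes> h \<otimes> inv g \<in> N"
      unfolding H.normal_inv_iff by (auto simp: inv_H)
    \<comment> \<open>For pairs with \<open>B \<noteq> \<one>\<close> the claim has to be stated for the quotient, to survive the induction.\<close>
    have "inv B \<otimes> A \<in> N" if "(A, B) \<in> congruent_words I" for A B
      using that
    proof (induction rule: congruent_words.induct)
      case one
      show ?case using subgroup.one_closed[OF N_sub] by simp
    next
      case (snoc A B i a b)
      note car = closed[OF snoc.hyps(2)] congruent_words_carrier[OF snoc.hyps(1)]
      have "x i (- b) \<otimes> (inv B \<otimes> A) \<otimes> inv (x i (- b)) \<in> N"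
        by (rule N_conj[OF gen_subgroup_incl[OF snoc.hyps(2)] snoc.IH]) simp
      moreover have "x i (a - b) \<in> N"
        using N(2) gen_subgroup_incl[OF snoc.hyps(2,3)] by blast
      ultimately have "x i (- b) \<otimes> (inv B \<otimes> A) \<otimes> inv (x i (- b)) \<otimes> x i (a - b) \<in> N"
        using subgroup.m_closed[OF N_sub] by simp
      also have "x i (- b) \<otimes> (inv B \<otimes> A) \<otimes> inv (x i (- b)) \<otimes> x i (a - b)
          = x i (- b) \<otimes> (inv B \<otimes> A) \<otimes> (x i b \<otimes> x i (a - b))"
        using car snoc.hyps(2) by (simp add: uminus m_assoc)
      also have "x i b \<otimes> x i (a - b) = x i a"
        using add[OF snoc.hyps(2), of b "a - b"] by simp
      also have "x i (- b) \<otimes> (inv B \<otimes> A) \<otimes> x i a = inv (B \<otimes> x i b) \<otimes> (A \<otimes> x i a)"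
        using car snoc.hyps(2) by (simp add: inv_mult_group uminus m_assoc)
      finally show ?case .
    qed
    from this[of A \<one>] A show "A \<in> N" using congruent_words_carrier by fastforce
  qed
qed

lemma congruent_words_factor:
  assumes "(A, B) \<in> congruent_words I"
    and zero_I: "0 \<in> I" and uminus_I: "\<forall>a\<in>I. - a \<in> I"
  obtains N where "(N, \<one>) \<in> congruent_words I" and "A = B \<otimes> N"
proof -
  have B: "B \<in> gen_subgroup UNIV" using congruent_words_gen_subgroup[OF assms(1)] by blast
  have "(inv B \<otimes> A, inv B \<otimes> B) \<in> congruent_words I"
    by (intro congruent_words_mult congruent_words_inv congruent_words_diag assms B)
  then have "(inv B \<otimes> A, \<one>) \<in> congruent_words I" using gen_subgroup_carrier[OF B] by simp
  moreover have "A = B \<otimes> (inv B \<otimes> A)"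
    using congruent_words_carrier[OF assms(1)] by (simp add: m_assoc[symmetric])
  ultimately show ?thesis by (rule that)
qed

end

section \<open>Elementary operations on unimodular rows by symplectic ones\<close>

lemma sp_perm_sp_perm [simp]: "sp_perm (sp_perm i) = i"
  by (auto simp: sp_perm_def)

lemma sp_perm_neq [simp]: "sp_perm i \<noteq> i" "i \<noteq> sp_perm i"
  by (auto simp: sp_perm_def elim!: oddE)

lemma sp_perm_less [simp]: "sp_perm i < 2 * n \<longleftrightarrow> i < 2 * n"
  unfolding sp_perm_def by (cases "even i") (auto elim!: oddE evenE)

lemma sp_perm_eq_iff [simp]: "sp_perm i = sp_perm j \<longleftrightarrow> i = j"
  by (metis sp_perm_sp_perm)

definition add_at :: "nat \<Rightarrow> 'b \<Rightarrow> (nat \<Rightarrow> 'b) \<Rightarrow> nat \<Rightarrow> 'b::comm_ring_1" where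
  "add_at j z v = v(j := v j + z)"

text \<open>The row operations given by right multiplication with \<open>se_mat n i j z\<close>. Rows are functions here,
  so that composites of operations can be compared coordinate by coordinate.\<close>

definition sp_op :: "nat \<Rightarrow> nat \<Rightarrow> 'b \<Rightarrow> (nat \<Rightarrow> 'b) \<Rightarrow> nat \<Rightarrow> 'b::comm_ring_1" where
  "sp_op i j z v =
     (if i = sp_perm j then add_at j (z * v i) v
      else add_at (sp_perm i) (- ((-1) ^ (i + j) * z * v (sp_perm j))) (add_at j (z * v i) v))"

lemma add_at_add_at [simp]: "add_at j y (add_at j z v) = add_at j (z + y) v"
  by (simp add: add_at_def add.assoc)

lemma add_at_0 [simp]: "add_at j 0 v = v"
  by (simp add: add_at_def)

lemma add_at_apply: "add_at j z v k = (if k = j then v k + z else v k)"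
  by (simp add: add_at_def)

text \<open>All scalars are kept in a subring \<open>D\<close>. The relative theorem is an instance with \<open>D\<close> the ring
  of pairs congruent modulo an ideal; this ring depends on the ideal and so cannot be a type.\<close>

locale half_subring =
  fixes D :: "'b::comm_ring_1 set" and half :: 'b and n :: nat
  assumes one_closed: "1 \<in> D"
    and diff_closed: "a \<in> D \<Longrightarrow> b \<in> D \<Longrightarrow> a - b \<in> D"
    and mult_closed: "a \<in> D \<Longrightarrow> b \<in> D \<Longrightarrow> a * b \<in> D"
    and half: "half \<in> D" "half + half = 1"
begin

lemma zero_closed: "0 \<in> D"
  using diff_closed[OF one_closed one_closed] by simp

lemma uminus_closed: "a \<in> D \<Longrightarrow> - a \<in> D"
  using diff_closed[OF zero_closed, of a] by simp

lemma add_closed: "a \<in> D \<Longrightarrow> b \<in> D \<Longrightarrow> a + b \<in> D"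
  using diff_closed[of a "- b"] uminus_closed[of b] by simp

lemma sign_closed: "(-1) ^ m \<in> D"
  by (induction m) (auto intro: one_closed uminus_closed)

lemma sum_closed: "(\<And>k. k \<in> S \<Longrightarrow> f k \<in> D) \<Longrightarrow> sum f S \<in> D"
  by (induction S rule: infinite_finite_induct) (auto intro: zero_closed add_closed)

lemmas closed = zero_closed one_closed diff_closed mult_closed uminus_closed add_closed sign_closed
  half(1)

definition rows :: "(nat \<Rightarrow> 'b) set" where
  "rows = {v. \<forall>k < 2 * n. v k \<in> D}"

inductive sp_reach :: "(nat \<Rightarrow> 'b) \<Rightarrow> (nat \<Rightarrow> 'b) \<Rightarrow> bool" where
  refl: "sp_reach v v"
| step: "sp_reach v u \<Longrightarrow> i < 2 * n \<Longrightarrow> j < 2 * n \<Longrightarrow> i \<noteq> j \<Longrightarrow> z \<in> D \<Longrightarrow>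
    sp_reach v (sp_op i j z u)"

lemma sp_reach_op:
  "i < 2 * n \<Longrightarrow> j < 2 * n \<Longrightarrow> i \<noteq> j \<Longrightarrow> z \<in> D \<Longrightarrow> sp_reach v (sp_op i j z v)"
  by (intro sp_reach.intros)

lemma sp_reach_trans [trans]: "sp_reach v u \<Longrightarrow> sp_reach u w \<Longrightarrow> sp_reach v w"
  by (rotate_tac, induction rule: sp_reach.induct) (auto intro: sp_reach.step)

lemma rowsD: "v \<in> rows \<Longrightarrow> k < 2 * n \<Longrightarrow> v k \<in> D"
  by (simp add: rows_def)

lemma add_at_rows: "v \<in> rows \<Longrightarrow> z \<in> D \<Longrightarrow> add_at j z v \<in> rows"
  by (auto simp: rows_def add_at_def intro: add_closed)

lemma sp_op_rows:
  "v \<in> rows \<Longrightarrow> i < 2 * n \<Longrightarrow> j < 2 * n \<Longrightarrow> z \<in> D \<Longrightarrow> sp_op i j z v \<in> rows"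
  by (auto simp: sp_op_def add_at_rows closed rowsD)

lemma reach_long:
  assumes "j < 2 * n" "b \<in> D"
  shows "sp_reach v (add_at j (b * v (sp_perm j)) v)"
  using sp_reach_op[of "sp_perm j" j b v] assms by (simp add: sp_op_def)

text \<open>A short root element with coefficient \<open>b * v k\<close> adds \<open>b * (v k)\<^sup>2\<close> at \<open>j\<close>. It also changes the entry at
  \<open>sp_perm k\<close>, but by a multiple of \<open>v k\<close>, and a long root element takes this back.\<close>

lemma reach_square:
  assumes v: "v \<in> rows" and jk: "j < 2 * n" "k < 2 * n" "k \<noteq> j" "k \<noteq> sp_perm j"
    and b: "b \<in> D"
  shows "sp_reach v (add_at j (b * (v k * v k)) v)"
proof -
  define s :: 'b where "s = (-1) ^ (k + j)"
  define u where "u = sp_op k j (b * v k) v"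
  have s: "s \<in> D" unfolding s_def by (rule closed)
  have "sp_reach v u"
    unfolding u_def using assms by (intro sp_reach_op) (auto simp: closed rowsD)
  also have "sp_reach u (sp_op k (sp_perm k) (s * b * v (sp_perm j)) u)"
    using assms s by (intro sp_reach_op) (auto simp: closed rowsD)
  also have "sp_op k (sp_perm k) (s * b * v (sp_perm j)) u = add_at j (b * (v k * v k)) v"
    using jk unfolding u_def sp_op_def s_def[symmetric]
    by (auto simp: fun_eq_iff add_at_def algebra_simps)
  finally show ?thesis .
qed

text \<open>Polarization of the previous lemma: replacing \<open>v l\<close> by \<open>v l + v k\<close> for the time of one square
  operation adds \<open>c * (v l + v k)\<^sup>2\<close>; the two pure squares are then removed. This yields twice the
  product, and is the place where \<open>2\<close> must be invertible.\<close>

lemma reach_product: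
  assumes v: "v \<in> rows" and jk: "j < 2 * n" "k < 2 * n" "l < 2 * n"
      "k \<noteq> j" "k \<noteq> sp_perm j" "l \<noteq> j" "l \<noteq> sp_perm j"
    and b: "b \<in> D"
  shows "sp_reach v (add_at j (b * (v k * v l)) v)"
proof (cases "k = l")
  case True
  then show ?thesis using reach_square assms by simp
next
  case False
  define c where "c = half * b"
  have c: "c \<in> D" unfolding c_def using b by (intro closed)
  have cc: "c + c = b"
    unfolding c_def by (metis distrib_right half(2) mult_1)
  \<comment> \<open>This operation and its inverse move entries outside \<open>j\<close>, and do not read the entry at \<open>j\<close>.\<close>
  define u where "u = sp_op k l 1 v"
  have u: "u \<in> rows" unfolding u_def using assms by (intro sp_op_rows closed)
  have ul: "u l = v l + v k"
    using jk False by (auto simp: u_def sp_op_def add_at_def)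
  let ?x = "c * ((v l + v k) * (v l + v k))"
  have "sp_reach v u"
    unfolding u_def using assms False by (intro sp_reach_op) (auto simp: closed)
  also have "sp_reach u (add_at j ?x u)"
    using reach_square[OF u, of j l c] assms c by (simp add: ul)
  also have "sp_reach (add_at j ?x u) (sp_op k l (-1) (add_at j ?x u))"
    using assms False by (intro sp_reach_op) (auto simp: closed)
  also have "sp_op k l (-1) (add_at j ?x u) = add_at j ?x v"
    using jk False by (auto simp: u_def sp_op_def fun_eq_iff add_at_def)
  finally have 1: "sp_reach v (add_at j ?x v)" .
  let ?v1 = "add_at j ?x v"
  have v1: "?v1 \<in> rows" using v c jk by (simp add: add_at_rows closed rowsD)
  have v1_eq: "?v1 l = v l" "?v1 k = v k" using jk by (auto simp: add_at_apply)
  note 1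
  also have "sp_reach ?v1 (add_at j (- c * (v l * v l)) ?v1)"
    using reach_square[OF v1, of j l "- c"] jk c by (simp add: v1_eq uminus_closed)
  also (sp_reach_trans) have "sp_reach \<dots> (add_at j (- c * (v k * v k)) \<dots>)"
    using reach_square[of "add_at j (- c * (v l * v l)) ?v1" j k "- c"] v jk c
    by (simp add: v1_eq closed add_at_rows rowsD add_at_apply)
  also have "add_at j (- c * (v k * v k)) (add_at j (- c * (v l * v l)) ?v1)
      = add_at j ((c + c) * (v k * v l)) v"
    by (simp add: algebra_simps)
  finally show ?thesis by (simp only: cc)
qed

text \<open>Adding \<open>v j\<close> to the entry at \<open>k = sp_perm i\<close> first, the product operation for \<open>i\<close> and \<open>k\<close> contributes
  \<open>v i * v j\<close>. Undoing the first step with the new entry at \<open>j\<close> leaves an error at \<open>k\<close> which is a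
  multiple of \<open>v i\<close>, that is, one that a long root element removes.\<close>

lemma reach_self_product:
  assumes v: "v \<in> rows" and ij: "i < 2 * n" "j < 2 * n" "i \<noteq> j" "i \<noteq> sp_perm j"
    and b: "b \<in> D"
  shows "sp_reach v (add_at j (b * (v i * v j)) v)"
proof -
  let ?k = "sp_perm i"
  have ne: "?k \<noteq> j" "?k \<noteq> sp_perm j" "sp_perm j \<noteq> i" using ij by auto
  define y where "y = b * (v i * (v ?k + v j))"
  define u where "u = sp_op j ?k 1 v"
  have u: "u \<in> rows" unfolding u_def using assms by (intro sp_op_rows closed) auto
  have u_eq: "u i = v i" "u ?k = v ?k + v j" "u j = v j"
    using ij ne by (auto simp: u_def sp_op_def add_at_def)
  have "sp_reach v u"
    unfolding u_def using assms ne by (intro sp_reach_op) (auto simp: closed)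
  also have "sp_reach u (add_at j y u)"
    using reach_product[OF u, of j i ?k b] assms ne by (simp add: u_eq y_def)
  also have "sp_reach (add_at j y u) (sp_op j ?k (-1) (add_at j y u))"
    using assms ne by (intro sp_reach_op) (auto simp: closed)
  also have "sp_op j ?k (-1) (add_at j y u) = add_at ?k (- y) (add_at j y v)"
    using ij ne by (auto simp: u_def sp_op_def fun_eq_iff add_at_def)
  also have "sp_reach \<dots> (add_at ?k (b * (v ?k + v j) * v i) \<dots>)"
    using reach_long[of ?k "b * (v ?k + v j)" "add_at ?k (- y) (add_at j y v)"] assms ne
    by (simp add: closed rowsD add_at_apply)
  also have "add_at ?k (b * (v ?k + v j) * v i) (add_at ?k (- y) (add_at j y v)) = add_at j y v"
    by (simp add: y_def mult_ac)
  also have "sp_reach \<dots> (add_at j (- b * (v i * v ?k)) \<dots>)"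
    using reach_product[of "add_at j y v" j i ?k "- b"] assms ne
    by (simp add: y_def closed add_at_rows rowsD add_at_apply)
  also have "add_at j (- b * (v i * v ?k)) (add_at j y v) = add_at j (b * (v i * v j)) v"
    by (simp add: y_def algebra_simps)
  finally show ?thesis .
qed

text \<open>The entries other than the one at \<open>j\<close> do not change, so the product operations accumulate,
  and so does the long root operation that stands in for them at \<open>k = sp_perm j\<close>.\<close>

lemma reach_partial_sum:
  assumes v: "v \<in> rows" and ij: "i < 2 * n" "j < 2 * n" "i \<noteq> j" "i \<noteq> sp_perm j"
    and b: "b \<in> D" and q: "q \<in> rows"
    and S: "finite S" "S \<subseteq> {..<2 * n} - {j}"
  shows "sp_reach v (add_at j (b * v i * (\<Sum>k\<in>S. q k * v k)) v)"
  using S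
proof (induction S rule: finite_induct)
  case empty
  show ?case by (simp add: sp_reach.refl)
next
  case (insert k S)
  let ?u = "add_at j (b * v i * (\<Sum>k\<in>S. q k * v k)) v"
  have k: "k < 2 * n" "k \<noteq> j" using insert.prems by auto
  have u: "?u \<in> rows"
    using insert.prems v q b ij by (auto simp: subset_iff intro!: add_at_rows mult_closed sum_closed intro: rowsD)
  have "sp_reach v ?u" using insert by auto
  also have "sp_reach ?u (add_at j (b * v i * (q k * v k)) ?u)"
  proof (cases "k = sp_perm j")
    case True
    then show ?thesis
      using reach_long[of j "b * v i * q k" ?u] k ij b v q
      by (simp add: closed rowsD add_at_apply mult.assoc)
  next
    case False
    then show ?thesis
      using reach_product[OF u, of j i k "b * q k"] k ij b v q
      by (simp add: closed rowsD add_at_apply mult_ac)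
  qed
  also have "add_at j (b * v i * (q k * v k)) ?u = add_at j (b * v i * (\<Sum>k\<in>insert k S. q k * v k)) v"
    using insert.hyps by (simp add: algebra_simps)
  finally show ?case .
qed

text \<open>An elementary operation adds \<open>b * v i\<close>, which is linear in the row, whereas the operations above
  add quadratic expressions. Unimodularity makes up for the degree:
  \<open>b * v i = (\<Sum>k. b * v i * q k * v k)\<close>. The summand with \<open>k = j\<close> is the self
  product, and the others have been dealt with as a partial sum.\<close>

theorem reach_elementary:
  assumes v: "v \<in> rows" and ij: "i < 2 * n" "j < 2 * n" "i \<noteq> j"
    and b: "b \<in> D" and q: "q \<in> rows" and vq: "(\<Sum>k<2 * n. q k * v k) = 1"
  shows "sp_reach v (add_at j (b * v i) v)"
proof (cases "i = sp_perm j")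
  case True
  then show ?thesis using reach_long ij b by simp
next
  case False
  define t where "t = 1 - q j * v j"
  let ?u = "add_at j (b * v i * t) v"
  have t: "t = (\<Sum>k\<in>{..<2 * n} - {j}. q k * v k)"
    using vq ij sum.remove[of "{..<2*n}" j "\<lambda>k. q k * v k"] by (simp add: t_def algebra_simps)
  have tD: "t \<in> D" unfolding t_def using v q ij by (intro closed rowsD)
  have u: "?u \<in> rows" using v b ij tD by (simp add: add_at_rows closed rowsD)
  let ?w = "add_at j (b * q j * (v i * (v j + b * v i * t))) ?u"
  have w: "?w \<in> rows" using u v b q ij tD by (simp add: add_at_rows closed rowsD)
  \<comment> \<open>The self product is taken at the entry \<open>v j + b * v i * t\<close>; its excess is a multiple of \<open>(v i)\<^sup>2\<close>.\<close>
  have "sp_reach v ?u"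
    using reach_partial_sum[of v i j b q "{..<2 * n} - {j}"] assms False by (simp add: t)
  also have "sp_reach ?u ?w"
    using reach_self_product[OF u, of i j "b * q j"] ij b q False
    by (simp add: closed rowsD add_at_apply)
  also have "sp_reach ?w (add_at j (- (b * b * q j * t) * (v i * v i)) ?w)"
    using reach_square[OF w, of j i "- (b * b * q j * t)"] ij b q tD False
    by (simp add: closed rowsD add_at_apply)
  also have "add_at j (- (b * b * q j * t) * (v i * v i)) ?w
      = add_at j (b * v i * (t + q j * v j)) v"
    by (simp add: algebra_simps)
  also have "b * v i * (t + q j * v j) = b * v i" by (simp add: t_def)
  finally show ?thesis .
qed

end

section \<open>Row operations and matrices\<close>

lemma row_mult_vec:
  "M \<in> carrier_mat k k \<Longrightarrow> row_mult (vec k f) M = vec k (\<lambda>q. \<Sum>r<k. f r * M $$ (r, q))"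
  by (auto simp: row_mult_def scalar_prod_def lessThan_atLeast0)

lemma row_mult_closed [simp]: "M \<in> carrier_mat k k \<Longrightarrow> row_mult v M \<in> carrier_vec k"
  by (auto simp: row_mult_def)

lemma row_mult_transpose: "row_mult v M = transpose_mat M *\<^sub>v v" if "M \<in> carrier_mat k k" "v \<in> carrier_vec k"
  using that by (intro eq_vecI) (auto simp: row_mult_def intro: comm_scalar_prod)

lemma row_mult_one [simp]: "v \<in> carrier_vec k \<Longrightarrow> row_mult v (1\<^sub>m k) = v"
  by (subst row_mult_transpose[of _ k]) (auto simp: transpose_one)

lemma row_mult_mult:
  assumes "A \<in> carrier_mat k k" "B \<in> carrier_mat k k" "v \<in> carrier_vec k"
  shows "row_mult v (A * B) = row_mult (row_mult v A) B"
proof -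
  have "row_mult v (A * B) = transpose_mat (A * B) *\<^sub>v v"
    using assms by (intro row_mult_transpose[of _ k]) auto
  also have "\<dots> = transpose_mat B *\<^sub>v (transpose_mat A *\<^sub>v v)"
    using assms by (simp add: transpose_mult[of A k k B k])
  also have "\<dots> = row_mult (row_mult v A) B"
    using assms by (simp add: row_mult_transpose[of _ k])
  finally show ?thesis .
qed

text \<open>Identities between products of elementary matrices become identities between composites of row
  operations.\<close>

lemma mat_eqI_row_mult:
  assumes M: "M \<in> carrier_mat k k" and N: "N \<in> carrier_mat k k"
    and eq: "\<And>f. row_mult (vec k f) M = row_mult (vec k f) N"
  shows "M = N"
proof (rule eq_matI)
  fix p q assume "p < dim_row N" "q < dim_col N"
  then have pq: "p < k" "q < k" using N by auto
  have *: "row_mult (vec k (\<lambda>r. if r = p then 1 else 0)) A $ q = A $$ (p, q)"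
    if "A \<in> carrier_mat k k" for A :: "'a mat"
    using pq by (simp add: row_mult_vec[OF that] if_distrib[of "\<lambda>x. x * _"] cong: if_cong)
  show "M $$ (p, q) = N $$ (p, q)"
    using *[OF M] *[OF N] eq by metis
qed (use M N in auto)

lemma mat_unit_carrier [simp]: "mat_unit k i j \<in> carrier_mat k k"
  by (simp add: mat_unit_def)

lemma elem_mat_carrier [simp]: "elem_mat k i j a \<in> carrier_mat k k"
  by (simp add: elem_mat_def)

lemma se_mat_carrier [simp]: "se_mat n i j z \<in> carrier_mat (2 * n) (2 * n)"
  by (auto simp: se_mat_def intro!: minus_carrier_mat)

lemma mat_unit_sum:
  assumes "i < k" "q < k"
  shows "(\<Sum>r<k. f r * mat_unit k i j $$ (r, q)) = (if q = j then f i else 0)"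
  using assms by (simp add: mat_unit_def if_distrib[of "\<lambda>x. _ * x"] cong: if_cong)

lemma one_mat_sum:
  assumes "q < k"
  shows "(\<Sum>r<k. f r * (1\<^sub>m k :: 'a::comm_ring_1 mat) $$ (r, q)) = f q"
  using assms by (simp add: if_distrib[of "\<lambda>x. _ * x"] cong: if_cong)

lemma row_mult_elem_mat:
  assumes "i < k"
  shows "row_mult (vec k f) (elem_mat k i j a) = vec k (add_at j (a * f i) f)"
proof (rule eq_vecI)
  fix q assume "q < dim_vec (vec k (add_at j (a * f i) f))"
  then have q: "q < k" by simp
  have "row_mult (vec k f) (elem_mat k i j a) $ q = (\<Sum>r<k. f r * elem_mat k i j a $$ (r, q))"
    using q by (simp add: row_mult_vec[OF elem_mat_carrier])
  also have "\<dots> = (\<Sum>r<k. f r * 1\<^sub>m k $$ (r, q) + a * (f r * mat_unit k i j $$ (r, q)))"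
    by (rule sum.cong) (use q in \<open>auto simp: elem_mat_def mat_unit_def distrib_left mult.commute\<close>)
  also have "\<dots> = (\<Sum>r<k. f r * 1\<^sub>m k $$ (r, q)) + a * (\<Sum>r<k. f r * mat_unit k i j $$ (r, q))"
    by (simp only: sum.distrib sum_distrib_left)
  also have "\<dots> = f q + a * (if q = j then f i else 0)"
    using q assms by (simp only: one_mat_sum mat_unit_sum)
  also have "\<dots> = vec k (add_at j (a * f i) f) $ q"
    using q by (auto simp: add_at_apply)
  finally show "row_mult (vec k f) (elem_mat k i j a) $ q = vec k (add_at j (a * f i) f) $ q" .
qed (use carrier_matD[OF elem_mat_carrier[of k i j a]] in \<open>auto simp: row_mult_def\<close>)

lemma se_mat_long: "se_mat n (sp_perm j) j z = elem_mat (2 * n) (sp_perm j) j z"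
  by (simp add: se_mat_def elem_mat_def)

lemma row_mult_se_mat:
  assumes "i < 2 * n" "j < 2 * n" "i \<noteq> j"
  shows "row_mult (vec (2 * n) f) (se_mat n i j z) = vec (2 * n) (sp_op i j z f)"
proof (cases "i = sp_perm j")
  case True
  then show ?thesis using assms by (simp add: se_mat_long row_mult_elem_mat sp_op_def)
next
  case False
  let ?c = "(-1) ^ (i + j) * z"
  let ?g = "add_at (sp_perm i) (- (?c * f (sp_perm j))) (add_at j (z * f i) f)"
  have sp_op: "sp_op i j z f = ?g" using False by (simp add: sp_op_def)
  show "row_mult (vec (2 * n) f) (se_mat n i j z) = vec (2 * n) (sp_op i j z f)"
    unfolding sp_op
  proof (rule eq_vecI)
    fix q assume "q < dim_vec (vec (2 * n) ?g)"
    then have q: "q < 2 * n" by simp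
    let ?u = "mat_unit (2 * n) i j" and ?u' = "mat_unit (2 * n) (sp_perm j) (sp_perm i)"
    have entry: "se_mat n i j z $$ (r, q) = 1\<^sub>m (2 * n) $$ (r, q) + z * ?u $$ (r, q) - ?c * ?u' $$ (r, q)"
      if "r < 2 * n" for r
      using that q False by (simp add: se_mat_def mat_unit_def)
    have "row_mult (vec (2 * n) f) (se_mat n i j z) $ q
        = (\<Sum>r<2*n. f r * se_mat n i j z $$ (r, q))"
      using q by (simp add: row_mult_vec[OF se_mat_carrier])
    also have "\<dots> = (\<Sum>r<2*n. f r * 1\<^sub>m (2 * n) $$ (r, q) + z * (f r * ?u $$ (r, q))
          - ?c * (f r * ?u' $$ (r, q)))"
      by (rule sum.cong) (simp_all only: lessThan_iff entry right_diff_distrib distrib_left mult_ac)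
    also have "\<dots> = (\<Sum>r<2*n. f r * 1\<^sub>m (2 * n) $$ (r, q)) + z * (\<Sum>r<2*n. f r * ?u $$ (r, q))
          - ?c * (\<Sum>r<2*n. f r * ?u' $$ (r, q))"
      by (simp only: sum.distrib sum_subtractf sum_distrib_left)
    finally have "row_mult (vec (2 * n) f) (se_mat n i j z) $ q
        = f q + z * (if q = j then f i else 0) - ?c * (if q = sp_perm i then f (sp_perm j) else 0)"
      using q assms by (simp only: one_mat_sum mat_unit_sum sp_perm_less)
    then show "row_mult (vec (2 * n) f) (se_mat n i j z) $ q = vec (2 * n) ?g $ q"
      using q assms by (auto simp: add_at_apply)
  qed (use carrier_matD[OF se_mat_carrier[of n i j z]] in \<open>auto simp: row_mult_def\<close>)
qed

lemma se_mat_short: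
  assumes "i < 2 * n" "j < 2 * n" "i \<noteq> j" "i \<noteq> sp_perm j"
  shows "se_mat n i j z = elem_mat (2 * n) i j z *
    elem_mat (2 * n) (sp_perm j) (sp_perm i) (- ((-1) ^ (i + j) * z))"
    (is "_ = ?A * ?B")
proof (rule mat_eqI_row_mult)
  fix f :: "nat \<Rightarrow> 'a"
  let ?s = "(-1) ^ (i + j) * z" and ?g = "add_at j (z * f i) f"
  have "row_mult (vec (2 * n) f) (?A * ?B) = row_mult (row_mult (vec (2 * n) f) ?A) ?B"
    by (rule row_mult_mult[of _ "2 * n"]) simp_all
  also have "\<dots> = vec (2 * n) (add_at (sp_perm i) (- ?s * ?g (sp_perm j)) ?g)"
    using assms by (simp only: row_mult_elem_mat sp_perm_less)
  also have "add_at (sp_perm i) (- ?s * ?g (sp_perm j)) ?g = sp_op i j z f"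
    using assms(4) by (simp add: sp_op_def add_at_apply)
  finally show "row_mult (vec (2 * n) f) (se_mat n i j z) = row_mult (vec (2 * n) f) (?A * ?B)"
    using row_mult_se_mat[OF assms(1-3)] by simp
qed (rule se_mat_carrier, rule mult_carrier_mat[of _ _ "2 * n"], rule elem_mat_carrier, rule elem_mat_carrier)

lemma group_GL: "group (GL k :: 'a::comm_ring_1 mat monoid)"
proof -
  interpret ring "ring_mat TYPE('a) k ()" by (rule ring_mat)
  show ?thesis unfolding GL_def by (rule units_group)
qed

lemma mult_GL [simp]: "A \<otimes>\<^bsub>GL k\<^esub> B = A * B"
  by (simp add: GL_def units_of_def ring_mat_simps)

lemma one_GL [simp]: "\<one>\<^bsub>GL k\<^esub> = 1\<^sub>m k"
  by (simp add: GL_def units_of_def ring_mat_simps)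

lemma GL_carrier_mat: "A \<in> carrier (GL k) \<Longrightarrow> A \<in> carrier_mat k k"
  by (simp add: GL_def units_of_def Units_def ring_mat_simps)

lemma additive_family_GL:
  fixes x :: "'i \<Rightarrow> 'a::comm_ring_1 \<Rightarrow> 'a mat"
  assumes car: "\<And>i a. i \<in> J \<Longrightarrow> x i a \<in> carrier_mat k k"
    and zero: "\<And>i. i \<in> J \<Longrightarrow> x i 0 = 1\<^sub>m k"
    and add: "\<And>i a b. i \<in> J \<Longrightarrow> x i (a + b) = x i a * x i b"
  shows "additive_family (GL k) J x"
proof (intro additive_family.intro group_GL additive_family_axioms.intro)
  fix i a b assume i: "i \<in> J"
  show "x i (a + b) = x i a \<otimes>\<^bsub>GL k\<^esub> x i b" using add[OF i] by simp
  have "x i a * x i (- a) = 1\<^sub>m k" "x i (- a) * x i a = 1\<^sub>m k"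
    using add[OF i, of a "- a"] add[OF i, of "- a" a] zero[OF i] by simp_all
  then show "x i a \<in> carrier (GL k)"
    using car[OF i] by (auto simp: GL_def units_of_def Units_def ring_mat_simps)
qed

definition off_diagonal :: "nat \<Rightarrow> (nat \<times> nat) set" where
  "off_diagonal k = {(i, j). i < k \<and> j < k \<and> i \<noteq> j}"

interpretation E: additive_family "GL k" "off_diagonal k"
    "case_prod (elem_mat k) :: nat \<times> nat \<Rightarrow> 'a::comm_ring_1 \<Rightarrow> 'a mat" for k
proof (rule additive_family_GL)
  fix p :: "nat \<times> nat" assume "p \<in> off_diagonal k"
  then obtain i j where p: "p = (i, j)" "i < k" "j < k" "i \<noteq> j" by (auto simp: off_diagonal_def)
  show "case_prod (elem_mat k) p (0 :: 'a) = 1\<^sub>m k"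
    unfolding p prod.case
    by (rule mat_eqI_row_mult[of _ k]) (auto simp: row_mult_elem_mat p)
  fix a b :: 'a
  show "case_prod (elem_mat k) p (a + b)
      = case_prod (elem_mat k) p a * case_prod (elem_mat k) p b"
    unfolding p prod.case
    using p by (intro mat_eqI_row_mult[of _ k])
      (auto simp: row_mult_elem_mat row_mult_mult[of _ k] add_at_apply distrib_right
        intro: mult_carrier_mat[of _ _ k])
qed auto

lemma sp_op_add: "i \<noteq> j \<Longrightarrow> sp_op i j (a + b) f = sp_op i j b (sp_op i j a f)"
  by (auto simp: sp_op_def add_at_def fun_eq_iff algebra_simps)

interpretation ESp: additive_family "GL (2 * n)" "off_diagonal (2 * n)"
    "case_prod (se_mat n) :: nat \<times> nat \<Rightarrow> 'a::comm_ring_1 \<Rightarrow> 'a mat" for n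
proof (rule additive_family_GL)
  fix p :: "nat \<times> nat" assume "p \<in> off_diagonal (2 * n)"
  then obtain i j where p: "p = (i, j)" "i < 2 * n" "j < 2 * n" "i \<noteq> j"
    by (auto simp: off_diagonal_def)
  show "case_prod (se_mat n) p (0 :: 'a) = 1\<^sub>m (2 * n)"
    unfolding p prod.case
    using p by (intro mat_eqI_row_mult[of _ "2 * n"]) (auto simp: row_mult_se_mat sp_op_def)
  fix a b :: 'a
  show "case_prod (se_mat n) p (a + b)
      = case_prod (se_mat n) p a * case_prod (se_mat n) p b"
    unfolding p prod.case
    using p by (intro mat_eqI_row_mult[of _ "2 * n"])
      (auto simp: row_mult_se_mat row_mult_mult[of _ "2 * n"] sp_op_add
        intro: mult_carrier_mat[of _ _ "2 * n"])
qed auto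

section \<open>The relative elementary groups\<close>

lemma E_gen_eq: "E_gen k X = E.gen_subgroup k X"
  unfolding E_gen_def E.gen_subgroup_def
  by (rule arg_cong[of _ _ "generate _"]) (fastforce simp: off_diagonal_def)

lemma ESp_gen_eq: "ESp_gen n X = ESp.gen_subgroup n X"
  unfolding ESp_gen_def ESp.gen_subgroup_def
  by (rule arg_cong[of _ _ "generate _"]) (fastforce simp: off_diagonal_def)

lemma ideal_class_ring:
  assumes "ideal I (class_ring :: 'a::comm_ring_1 ring)"
  shows "0 \<in> I" and "\<forall>a\<in>I. - a \<in> I"
    and "a \<in> I \<Longrightarrow> b \<in> I \<Longrightarrow> a - b \<in> I" and "a \<in> I \<Longrightarrow> r * a \<in> I"
proof -
  interpret I: ideal I "class_ring :: 'a ring" by fact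
  show "0 \<in> I" using I.zero_closed by simp
  show mult: "r * a \<in> I" if "a \<in> I" for a r using I.I_l_closed[OF that, of r] by simp
  have uminus: "- a \<in> I" if "a \<in> I" for a using mult[OF that, of "- 1"] by simp
  then show "\<forall>a\<in>I. - a \<in> I" by simp
  show "a - b \<in> I" if "a \<in> I" "b \<in> I"
    using I.a_closed[OF that(1) uminus[OF that(2)]] by simp
qed

lemma E_rel_eq:
  assumes "ideal I (class_ring :: 'a::comm_ring_1 ring)"
  shows "E_rel k I = {A. (A, 1\<^sub>m k) \<in> E.congruent_words k I}"
  unfolding E_rel_def E_gen_eq
  using E.normal_closure_eq_congruent_words[OF ideal_class_ring(1,2)[OF assms], of k] by simp

lemma ESp_rel_eq:
  assumes "ideal I (class_ring :: 'a::comm_ring_1 ring)"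
  shows "ESp_rel n I = {A. (A, 1\<^sub>m (2 * n)) \<in> ESp.congruent_words n I}"
  unfolding ESp_rel_def ESp_gen_eq
  using ESp.normal_closure_eq_congruent_words[OF ideal_class_ring(1,2)[OF assms], of n] by simp

lemma sp_perm_off_diagonal:
  "(i, j) \<in> off_diagonal (2 * n) \<Longrightarrow> (sp_perm j, sp_perm i) \<in> off_diagonal (2 * n)"
  by (auto simp: off_diagonal_def)

text \<open>Hence the relative symplectic group lies in the relative elementary group: a short root generator
  is a product of two elementary matrices whose coefficients are equal up to sign.\<close>

lemma ESp_words_subset_E_words:
  fixes I :: "'a::comm_ring_1 set"
  assumes I: "ideal I (class_ring :: 'a ring)"
    and AB: "(A, B) \<in> ESp.congruent_words n I"
  shows "(A, B) \<in> E.congruent_words (2 * n) I"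
  using AB
proof (induction rule: ESp.congruent_words.induct)
  case one
  show ?case by (rule E.congruent_words.one)
next
  case (snoc A B p a b)
  obtain i j where p: "p = (i, j)" by (cases p)
  then have ij: "(i, j) \<in> off_diagonal (2 * n)" using snoc.hyps by simp
  have "(se_mat n i j a, se_mat n i j b) \<in> E.congruent_words (2 * n) I"
  proof (cases "i = sp_perm j")
    case True
    then show ?thesis
      using E.congruent_words_gen[OF ij snoc.hyps(3)] by (simp add: se_mat_long)
  next
    case False
    let ?s = "(-1) ^ (i + j) :: 'a"
    have "- (?s * a) - - (?s * b) = - ?s * (a - b)" by (simp add: algebra_simps)
    then have "- (?s * a) - - (?s * b) \<in> I" using ideal_class_ring(4)[OF I snoc.hyps(3), of "- ?s"] by simp
    from E.congruent_words_mult[OF E.congruent_words_gen[OF ij snoc.hyps(3)]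
        E.congruent_words_gen[OF sp_perm_off_diagonal[OF ij] this]]
    show ?thesis using ij False by (simp add: se_mat_short off_diagonal_def)
  qed
  from E.congruent_words_mult[OF snoc.IH this] show ?case by (simp add: p)
qed

section \<open>Congruent pairs of scalars\<close>

text \<open>Pairs are encoded as functions on \<open>bool\<close>: the function type carries the ring structure of
  \<open>R \<times> R\<close>, and these pairs form the fibre product of \<open>R\<close> with itself over \<open>R / I\<close>.\<close>

definition congruent_pairs :: "'a::comm_ring_1 set \<Rightarrow> (bool \<Rightarrow> 'a) set" where
  "congruent_pairs I = {f. f True - f False \<in> I}"

lemma half_subring_congruent_pairs:
  fixes I :: "'a::comm_ring_1 set"
  assumes I: "ideal I (class_ring :: 'a ring)" and half: "h + h = (1 :: 'a)"
  shows "half_subring (congruent_pairs I) (\<lambda>_. h)"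
proof
  fix a b :: "bool \<Rightarrow> 'a" assume "a \<in> congruent_pairs I" "b \<in> congruent_pairs I"
  then have a: "a True - a False \<in> I" and b: "b True - b False \<in> I"
    by (auto simp: congruent_pairs_def)
  have "(a True - a False) - (b True - b False) \<in> I" by (rule ideal_class_ring(3)[OF I a b])
  then show "a - b \<in> congruent_pairs I" by (simp add: congruent_pairs_def algebra_simps)
  have "b True * (a True - a False) - (- a False) * (b True - b False) \<in> I"
    by (intro ideal_class_ring(3,4)[OF I] a b)
  then show "a * b \<in> congruent_pairs I" by (simp add: congruent_pairs_def algebra_simps)
qed (use ideal_class_ring(1)[OF I] half in \<open>auto simp: congruent_pairs_def fun_eq_iff\<close>)

lemma minus_one_power_apply: "((-1) ^ m :: 'c \<Rightarrow> 'a::comm_ring_1) t = (-1) ^ m"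
  by (induction m) auto

lemma sp_op_apply: "sp_op i j z u k t = sp_op i j (z t) (\<lambda>k. u k t) k"
  by (auto simp: sp_op_def add_at_def minus_one_power_apply)

lemma sp_reach_imp_congruent_words:
  fixes I :: "'a::comm_ring_1 set" and V F :: "nat \<Rightarrow> bool \<Rightarrow> 'a"
  assumes "half_subring (congruent_pairs I) h"
    and "half_subring.sp_reach (congruent_pairs I) n V F"
  shows "\<exists>A B. (A, B) \<in> ESp.congruent_words n I
    \<and> row_mult (vec (2 * n) (\<lambda>k. V k True)) A = vec (2 * n) (\<lambda>k. F k True)
    \<and> row_mult (vec (2 * n) (\<lambda>k. V k False)) B = vec (2 * n) (\<lambda>k. F k False)"
proof -
  interpret half_subring "congruent_pairs I" h n by fact
  let ?row = "\<lambda>F t. vec (2 * n) (\<lambda>k. F k t)"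
  show ?thesis using assms(2)
  proof (induction rule: sp_reach.induct)
    case (refl V)
    have "row_mult (?row V t) (1\<^sub>m (2 * n)) = ?row V t" for t
      by (rule row_mult_one) simp
    then show ?case
      using ESp.congruent_words.one[of n I]
      by (intro exI[of _ "1\<^sub>m (2 * n)"] conjI) simp_all
  next
    case (step V u i j z)
    then obtain A B where AB: "(A, B) \<in> ESp.congruent_words n I"
      "row_mult (?row V True) A = ?row u True" "row_mult (?row V False) B = ?row u False" by auto
    have "(i, j) \<in> off_diagonal (2 * n)" using step by (simp add: off_diagonal_def)
    from ESp.congruent_words.snoc[OF AB(1) this, of "z True" "z False"]
    have "(A * se_mat n i j (z True), B * se_mat n i j (z False)) \<in> ESp.congruent_words n I"
      using \<open>z \<in> congruent_pairs I\<close> by (simp add: congruent_pairs_def)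
    moreover have "row_mult (?row V t) (M * se_mat n i j (z t)) = ?row (sp_op i j z u) t"
      if "row_mult (?row V t) M = ?row u t" "M \<in> carrier (GL (2 * n))" for M t
      using that step GL_carrier_mat[OF that(2)]
      by (subst row_mult_mult[of _ "2 * n"]) (auto simp: row_mult_se_mat sp_op_apply)
    ultimately show ?case using AB ESp.congruent_words_carrier[OF AB(1)] by blast
  qed
qed

text \<open>With \<open>y = c * F i\<close> and \<open>x = - (c * q j)\<close> the two correction terms cancel, so that the pairing of a row
  with its unimodularity witness is invariant.\<close>

lemma sum_add_at_mult:
  fixes q F :: "nat \<Rightarrow> 'b::comm_ring_1"
  assumes "i < m" "j < m" "i \<noteq> j"
  shows "(\<Sum>k<m. add_at i x q k * add_at j y F k) = (\<Sum>k<m. q k * F k) + q j * y + x * F i"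
proof -
  have "add_at i x q k * add_at j y F k
      = q k * F k + (if k = j then q j * y else 0) + (if k = i then x * F i else 0)" for k
    using assms by (auto simp: add_at_apply algebra_simps)
  then show ?thesis using assms by (simp add: sum.distrib)
qed

text \<open>Here the theorem on elementary operations is applied over the ring of congruent pairs, to the
  constant pair \<open>(v, v)\<close>. Each elementary operation transforms the row \<open>q\<close> that witnesses
  unimodularity by the inverse operation.\<close>

lemma E_words_simulated_by_ESp_words:
  fixes I :: "'a::comm_ring_1 set"
  assumes I: "ideal I (class_ring :: 'a ring)" and half: "h + h = (1 :: 'a)"
    and v: "v \<in> carrier_vec (2 * n)" and w: "w \<in> carrier_vec (2 * n)" and vw: "v \<bullet> w = 1"
    and AB: "(A, B) \<in> E.congruent_words (2 * n) I"
  shows "\<exists>A' B'. (A', B') \<in> ESp.congruent_words n I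
    \<and> row_mult v A' = row_mult v A \<and> row_mult v B' = row_mult v B"
proof -
  interpret half_subring "congruent_pairs I" "\<lambda>_. h" n
    by (rule half_subring_congruent_pairs[OF I half])
  define V :: "nat \<Rightarrow> bool \<Rightarrow> 'a" where "V k t = v $ k" for k t
  let ?row = "\<lambda>F t. vec (2 * n) (\<lambda>k. F k t)"
  have V: "?row V t = v" for t using v by (auto simp: V_def)
  have "\<exists>F q. sp_reach V F \<and> F \<in> rows \<and> q \<in> rows \<and> (\<Sum>k<2 * n. q k * F k) = 1
      \<and> row_mult v A = ?row F True \<and> row_mult v B = ?row F False"
    using AB
  proof (induction rule: E.congruent_words.induct)
    case one
    define q :: "nat \<Rightarrow> bool \<Rightarrow> 'a" where "q k t = w $ k" for k t
    have "(\<Sum>k<2 * n. q k * V k) t = 1" for t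
    proof -
      have "(\<Sum>k\<in>S. q k * V k) t = (\<Sum>k\<in>S. v $ k * w $ k)" for S
        by (induction S rule: infinite_finite_induct) (auto simp: q_def V_def)
      then show ?thesis using vw w by (simp add: scalar_prod_def lessThan_atLeast0)
    qed
    then have "(\<Sum>k<2 * n. q k * V k) = 1" by (auto simp: fun_eq_iff)
    moreover have "V k \<in> congruent_pairs I" "q k \<in> congruent_pairs I" for k
      using ideal_class_ring(1)[OF I] by (simp_all add: V_def q_def congruent_pairs_def)
    then have "V \<in> rows" "q \<in> rows" by (auto simp: rows_def)
    ultimately show ?case
      using V row_mult_one[OF v] sp_reach.refl[of V]
      by - (rule exI[of _ V], rule exI[of _ q], (intro conjI; (assumption | simp)))
  next
    case (snoc A B p a b)
    then obtain F q where F: "sp_reach V F" "F \<in> rows" "q \<in> rows" "(\<Sum>k<2 * n. q k * F k) = 1"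
      "row_mult v A = ?row F True" "row_mult v B = ?row F False" by blast
    obtain i j where p: "p = (i, j)" and ij: "i < 2 * n" "j < 2 * n" "i \<noteq> j"
      using snoc.hyps by (auto simp: off_diagonal_def)
    define c where "c t = (if t then a else b)" for t
    have c: "c \<in> congruent_pairs I" using snoc.hyps by (simp add: c_def congruent_pairs_def)
    let ?F = "add_at j (c * F i) F" and ?q = "add_at i (- (c * q j)) q"
    have "sp_reach F ?F" by (rule reach_elementary) (use F ij c in auto)
    with F(1) have "sp_reach V ?F" by (rule sp_reach_trans)
    moreover have "?F \<in> rows" "?q \<in> rows"
      using F c ij by (simp_all add: add_at_rows closed rowsD)
    moreover have "(\<Sum>k<2 * n. ?q k * ?F k) = 1"
      using F(4) ij by (simp add: sum_add_at_mult algebra_simps)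
    moreover have "row_mult v (M * elem_mat (2 * n) i j (c t)) = ?row ?F t"
      if "row_mult v M = ?row F t" "M \<in> carrier (GL (2 * n))" for M t
      using that ij v GL_carrier_mat[OF that(2)]
      by (subst row_mult_mult[of _ "2 * n"]) (auto simp: row_mult_elem_mat add_at_apply)
    from this[OF F(5)] this[OF F(6)]
    have "row_mult v (A * elem_mat (2 * n) i j a) = ?row ?F True"
      "row_mult v (B * elem_mat (2 * n) i j b) = ?row ?F False"
      using E.congruent_words_carrier[OF snoc.hyps(1)] by (auto simp: c_def)
    ultimately show ?case
      unfolding p prod.case mult_GL
      by - (rule exI[of _ ?F], rule exI[of _ ?q], (intro conjI; assumption))
  qed
  then obtain F where "sp_reach V F" "row_mult v A = ?row F True" "row_mult v B = ?row F False"
    by blast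
  with sp_reach_imp_congruent_words[OF half_subring_axioms, of n V F] show ?thesis
    by (simp add: V)
qed

section \<open>Equality of the orbits\<close>

text \<open>For \<open>M\<close> in the relative elementary group the pair \<open>(M, 1)\<close> is a word over the congruent pairs.
  Simulating it at \<open>(v, v)\<close> by a symplectic pair \<open>(A, B)\<close> gives \<open>v A = v M\<close> and \<open>v B = v\<close>. In general
  \<open>B\<close> is only some stabilizer of \<open>v\<close>, but \<open>A = B N\<close> with \<open>N\<close> in the relative symplectic group, and
  therefore \<open>v M = v B N = v N\<close>.\<close>

theorem row_orbit_E_rel_eq_ESp_rel:
  fixes I :: "'a::comm_ring_1 set"
  assumes I: "ideal I (class_ring :: 'a ring)" and half: "h + h = (1 :: 'a)"
    and v: "v \<in> carrier_vec (2 * n)" and w: "w \<in> carrier_vec (2 * n)" and vw: "v \<bullet> w = 1"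
  shows "row_orbit (E_rel (2 * n) I) v = row_orbit (ESp_rel n I) v"
proof
  note rel = E_rel_eq[OF I] ESp_rel_eq[OF I]
  show "row_orbit (ESp_rel n I) v \<subseteq> row_orbit (E_rel (2 * n) I) v"
    unfolding rel row_orbit_def using ESp_words_subset_E_words[OF I] by blast
  show "row_orbit (E_rel (2 * n) I) v \<subseteq> row_orbit (ESp_rel n I) v"
    unfolding row_orbit_def
  proof clarify
    fix M assume "M \<in> E_rel (2 * n) I"
    then have "(M, 1\<^sub>m (2 * n)) \<in> E.congruent_words (2 * n) I" by (simp add: rel)
    from E_words_simulated_by_ESp_words[OF I half v w vw this]
    obtain A B where AB: "(A, B) \<in> ESp.congruent_words n I"
      and vA: "row_mult v A = row_mult v M" and vB: "row_mult v B = v" using v by auto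
    obtain N where N: "(N, 1\<^sub>m (2 * n)) \<in> ESp.congruent_words n I" "A = B * N"
      using ESp.congruent_words_factor[OF AB ideal_class_ring(1,2)[OF I]] by auto
    have "B \<in> carrier_mat (2 * n) (2 * n)" "N \<in> carrier_mat (2 * n) (2 * n)"
      using ESp.congruent_words_carrier[OF AB] ESp.congruent_words_carrier[OF N(1)]
      by (auto intro: GL_carrier_mat)
    then have "row_mult v A = row_mult v N"
      using v by (simp add: N(2) row_mult_mult[of _ "2 * n"] vB)
    then show "\<exists>N'. row_mult v M = row_mult v N' \<and> N' \<in> ESp_rel n I"
      using N(1) vA by (auto simp: rel intro!: exI[of _ N])
  qed
qed

lemma orbit_map_row_orbit:
  fixes v :: "'a::comm_ring_1 vec"
  assumes v: "v \<in> carrier_vec k" and H: "subgroup H (GL k)"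
  shows "orbit_map H (row_orbit H v) = row_orbit H v"
proof -
  have car: "A \<in> carrier_mat k k" if "A \<in> H" for A
    using that subgroup.subset[OF H] GL_carrier_mat by blast
  have one: "1\<^sub>m k \<in> H" using subgroup.one_closed[OF H] by simp
  have mult: "A * B \<in> H" if "A \<in> H" "B \<in> H" for A B using subgroup.m_closed[OF H that] by simp
  have assoc: "row_mult (row_mult v A) B = row_mult v (A * B)" if "A \<in> H" "B \<in> H" for A B
    using row_mult_mult[OF car car v] that by simp
  show ?thesis
    unfolding orbit_map_def row_orbit_def
  proof (intro equalityI subsetI)
    fix u assume "u \<in> {row_mult v A |A. A \<in> H}"
    then obtain A where "A \<in> H" "u = row_mult (row_mult v (1\<^sub>m k)) A" using v by auto
    with one show "u \<in> (\<Union>w\<in>{row_mult v A |A. A \<in> H}. {row_mult w B |B. B \<in> H})" by blast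
  next
    fix u assume "u \<in> (\<Union>w\<in>{row_mult v A |A. A \<in> H}. {row_mult w B |B. B \<in> H})"
    then show "u \<in> {row_mult v A |A. A \<in> H}" using assoc mult by auto
  qed
qed

theorem theorem7p11:
  fixes I :: "'a::comm_ring_1 set" and n :: nat
  assumes "range (\<lambda>r::'a. 2 * r) = UNIV"
    and "ideal I (class_ring :: 'a ring)"
    and "n \<ge> 2"
  shows "(\<forall>v \<in> Um (2 * n) I.
            orbit_map (E_rel (2 * n) I) (row_orbit (ESp_rel n I) v) = row_orbit (E_rel (2 * n) I) v)
       \<and> bij_betw (orbit_map (E_rel (2 * n) I))
           (row_orbits (Um (2 * n) I) (ESp_rel n I))
           (row_orbits (Um (2 * n) I) (E_rel (2 * n) I))"
proof -
  obtain h :: 'a where h: "h + h = 1"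
    using assms(1) by (metis UNIV_I imageE mult_2)
  let ?K = "E_rel (2 * n) I" and ?U = "Um (2 * n) I"
  have orbit_eq: "row_orbit ?K v = row_orbit (ESp_rel n I) v" if "v \<in> ?U" for v
    using that row_orbit_E_rel_eq_ESp_rel[OF assms(2) h] by (auto simp: Um_def)
  have "subgroup ?K (GL (2 * n))"
    unfolding E_rel_eq[OF assms(2)]
    using E.subgroup_kernel[OF ideal_class_ring(2)[OF assms(2)]] by simp
  then have map_orbit: "orbit_map ?K (row_orbit ?K v) = row_orbit ?K v" if "v \<in> ?U" for v
    using that by (intro orbit_map_row_orbit) (auto simp: Um_def)
  \<comment> \<open>Both orbit sets coincide as sets of sets, and the orbit map is the identity on them.\<close>
  have "row_orbits ?U (ESp_rel n I) = row_orbits ?U ?K"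
    unfolding row_orbits_def using orbit_eq by (metis (no_types, lifting))
  moreover have "bij_betw (orbit_map ?K) (row_orbits ?U ?K) (row_orbits ?U ?K)"
  proof (subst bij_betw_cong[where g = id])
    show "orbit_map ?K C = id C" if "C \<in> row_orbits ?U ?K" for C
      using that map_orbit by (auto simp: row_orbits_def)
  qed simp
  ultimately show ?thesis using orbit_eq map_orbit by simp
qed

end
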